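(* Let $T\in\mathbb{N}$, let $\mathcal{X},\mathcal{U},\mathcal{Y}$ be Polish spaces, let $f:\mathcal{X}\times\mathcal{U}\to\mathcal{X}$ and $h:\mathcal{X}\times\mathcal{U}\to\mathcal{Y}$ be continuous, and let $d_{\mathcal{X}},d_{\mathcal{Y}}$ be compatible bounded metrics on $\mathcal{X},\mathcal{Y}$. For $t=0,\dots,T-1$ define $\mathcal{L}_t:C_b(\mathcal{X})\to C_b(\Omega_T)$ and $\mathcal{H}_t:C_b(\mathcal{Y})\to C_b(\Omega_T)$ by $$(\mathcal{L}_t\varphi)(\omega):=\varphi(X_{t+1}(\omega))-\varphi\bigl(f(X_t(\omega),U_t(\omega))\bigr),\qquad (\mathcal{H}_t\psi)(\omega):=\psi(Y_t(\omega))-\psi\bigl(h(X_t(\omega),U_t(\omega))\bigr).$$ For $\mu\in\mathcal{P}(\Omega_T)$ consider the conditions: (i) (Graph support) $\mu(\mathfrak{B}_T)=1$, i.e. $\mu\in\mathcal{M}_{\mathcal{B}}$. (ii) (Metric residual) For every $t=0,\dots,T-1$, $$\int_{\Omega_T}\Bigl[d_{\mathcal{X}}\bigl(X_{t+1},f(X_t,U_t)\bigr)^2+d_{\mathcal{Y}}\bigl(Y_t,h(X_t,U_t)\bigr)^2\Bigr]\,d\mu=0.$$ (iii) (Weak operator identities) For every $t=0,\dots,T-1$, every $\varphi\in C_b(\mathcal{X})$ and every $\psi\in C_b(\mathcal{Y})$, $$\int_{\Omega_T}\mathcal{L}_t\varphi\,d\mu=0,\qquad\int_{\Omega_T}\mathcal{H}_t\psi\,d\mu=0.$$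 Then for every $\mu\in\mathcal{P}(\Omega_T)$, (i) $\Leftrightarrow$ (ii) $\Rightarrow$ (iii). The reverse implication (iii) $\Rightarrow$ (i) fails in general: there exist $T$, Polish spaces $\mathcal{X},\mathcal{U},\mathcal{Y}$, continuous $f,h$, and $\mu\in\mathcal{P}(\Omega_T)$ satisfying (iii) but not (i).
   Context: For a Polish space $S$, $\mathcal{P}(S)$ denotes the set of Borel probability measures on $S$ and $C_b(S)$ the bounded continuous real-valued functions on $S$. The trajectory space is $\Omega_T:=\mathcal{X}^{T+1}\times\mathcal{U}^T\times\mathcal{Y}^T$ with its product topology and Borel $\sigma$-algebra. For $\omega=(x_{0:T},u_{0:T-1},y_{0:T-1})\in\Omega_T$ the coordinate maps are $X_t(\omega)=x_t$, $U_t(\omega)=u_t$, $Y_t(\omega)=y_t$. The admissible path set is $$\mathfrak{B}_T:=\{\omega\in\Omega_T: X_{t+1}(\omega)=f(X_t(\omega),U_t(\omega)),\ Y_t(\omega)=h(X_t(\omega),U_t(\omega)),\ t=0,\dots,T-1\}.$$ The behavioral-measure set is $\mathcal{M}_{\mathcal{B}}:=\{\mu\in\mathcal{P}(\Omega_T):\mu(\mathfrak{B}_T)=1\}$. *)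

theory Defs
  imports "HOL-Probability.Probability"
begin

text \<open>
  Spaces are topologies in the sense of the abstract topology library, so that the trajectory space
  with a variable horizon is a space of the same kind as its factors and one can quantify over
  spaces inside a formula.
\<close>

definition polish_topology :: "'a topology \<Rightarrow> bool" where
  "polish_topology X \<longleftrightarrow> completely_metrizable_space X \<and> separable_space X"

definition compatible_bounded_metric :: "'a topology \<Rightarrow> ('a \<Rightarrow> 'a \<Rightarrow> real) \<Rightarrow> bool" where
  "compatible_bounded_metric X d \<longleftrightarrow>
     Metric_space (topspace X) d \<and> Metric_space.mtopology (topspace X) d = X \<and>
     Metric_space.mbounded (topspace X) d (topspace X)"

definition borel_measure_of :: "'a topology \<Rightarrow> 'a measure" where
  "borel_measure_of X = sigma (topspace X) {G. openin X G}"

definition borel_probs :: "'a topology \<Rightarrow> 'a measure set" where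
  "borel_probs X = {\<mu>. prob_space \<mu> \<and> sets \<mu> = sets (borel_measure_of X)}"

text \<open>Functions are total on the type; their values off the carrier are irrelevant.\<close>

definition Cb :: "'a topology \<Rightarrow> ('a \<Rightarrow> real) set" where
  "Cb X = {\<phi>. continuous_map X euclideanreal \<phi> \<and> bounded (\<phi> ` topspace X)}"

type_synonym ('x, 'u, 'y) traj = "(nat \<Rightarrow> 'x) \<times> (nat \<Rightarrow> 'u) \<times> (nat \<Rightarrow> 'y)"

definition traj_space ::
  "nat \<Rightarrow> 'x topology \<Rightarrow> 'u topology \<Rightarrow> 'y topology \<Rightarrow> ('x, 'u, 'y) traj topology" where
  "traj_space T X U Y =
     prod_topology (product_topology (\<lambda>_. X) {0..T})
       (prod_topology (product_topology (\<lambda>_. U) {0..<T}) (product_topology (\<lambda>_. Y) {0..<T}))"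

definition coord_X :: "nat \<Rightarrow> ('x, 'u, 'y) traj \<Rightarrow> 'x" where
  "coord_X t \<omega> = fst \<omega> t"

definition coord_U :: "nat \<Rightarrow> ('x, 'u, 'y) traj \<Rightarrow> 'u" where
  "coord_U t \<omega> = fst (snd \<omega>) t"

definition coord_Y :: "nat \<Rightarrow> ('x, 'u, 'y) traj \<Rightarrow> 'y" where
  "coord_Y t \<omega> = snd (snd \<omega>) t"

definition admissible_paths ::
  "nat \<Rightarrow> 'x topology \<Rightarrow> 'u topology \<Rightarrow> 'y topology \<Rightarrow> ('x \<times> 'u \<Rightarrow> 'x) \<Rightarrow> ('x \<times> 'u \<Rightarrow> 'y)
     \<Rightarrow> ('x, 'u, 'y) traj set" where
  "admissible_paths T X U Y f h =
     {\<omega> \<in> topspace (traj_space T X U Y).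
        \<forall>t<T. coord_X (Suc t) \<omega> = f (coord_X t \<omega>, coord_U t \<omega>) \<and>
              coord_Y t \<omega> = h (coord_X t \<omega>, coord_U t \<omega>)}"

definition behavioral_measures ::
  "nat \<Rightarrow> 'x topology \<Rightarrow> 'u topology \<Rightarrow> 'y topology \<Rightarrow> ('x \<times> 'u \<Rightarrow> 'x) \<Rightarrow> ('x \<times> 'u \<Rightarrow> 'y)
     \<Rightarrow> ('x, 'u, 'y) traj measure set" where
  "behavioral_measures T X U Y f h =
     {\<mu> \<in> borel_probs (traj_space T X U Y). emeasure \<mu> (admissible_paths T X U Y f h) = 1}"

definition L_op :: "('x \<times> 'u \<Rightarrow> 'x) \<Rightarrow> nat \<Rightarrow> ('x \<Rightarrow> real) \<Rightarrow> ('x, 'u, 'y) traj \<Rightarrow> real" where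
  "L_op f t \<phi> \<omega> = \<phi> (coord_X (Suc t) \<omega>) - \<phi> (f (coord_X t \<omega>, coord_U t \<omega>))"

definition H_op :: "('x \<times> 'u \<Rightarrow> 'y) \<Rightarrow> nat \<Rightarrow> ('y \<Rightarrow> real) \<Rightarrow> ('x, 'u, 'y) traj \<Rightarrow> real" where
  "H_op h t \<psi> \<omega> = \<psi> (coord_Y t \<omega>) - \<psi> (h (coord_X t \<omega>, coord_U t \<omega>))"

definition metric_residual ::
  "('x \<times> 'u \<Rightarrow> 'x) \<Rightarrow> ('x \<times> 'u \<Rightarrow> 'y) \<Rightarrow> ('x \<Rightarrow> 'x \<Rightarrow> real) \<Rightarrow> ('y \<Rightarrow> 'y \<Rightarrow> real) \<Rightarrow> nat
     \<Rightarrow> ('x, 'u, 'y) traj \<Rightarrow> real" where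
  "metric_residual f h dX dY t \<omega> =
     (dX (coord_X (Suc t) \<omega>) (f (coord_X t \<omega>, coord_U t \<omega>)))\<^sup>2 +
     (dY (coord_Y t \<omega>) (h (coord_X t \<omega>, coord_U t \<omega>)))\<^sup>2"

definition metric_residual_condition ::
  "nat \<Rightarrow> ('x \<times> 'u \<Rightarrow> 'x) \<Rightarrow> ('x \<times> 'u \<Rightarrow> 'y) \<Rightarrow> ('x \<Rightarrow> 'x \<Rightarrow> real) \<Rightarrow> ('y \<Rightarrow> 'y \<Rightarrow> real)
     \<Rightarrow> ('x, 'u, 'y) traj measure \<Rightarrow> bool" where
  "metric_residual_condition T f h dX dY \<mu> \<longleftrightarrow>
     (\<forall>t<T. (\<integral>\<omega>. metric_residual f h dX dY t \<omega> \<partial>\<mu>) = 0)"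

definition weak_operator_identities ::
  "nat \<Rightarrow> 'x topology \<Rightarrow> 'y topology \<Rightarrow> ('x \<times> 'u \<Rightarrow> 'x) \<Rightarrow> ('x \<times> 'u \<Rightarrow> 'y)
     \<Rightarrow> ('x, 'u, 'y) traj measure \<Rightarrow> bool" where
  "weak_operator_identities T X Y f h \<mu> \<longleftrightarrow>
     (\<forall>t<T. \<forall>\<phi>\<in>Cb X. \<forall>\<psi>\<in>Cb Y.
        (\<integral>\<omega>. L_op f t \<phi> \<omega> \<partial>\<mu>) = 0 \<and> (\<integral>\<omega>. H_op h t \<psi> \<omega> \<partial>\<mu>) = 0)"

text \<open>
  The Bochner integral of a non-integrable function is 0 by convention, and so is the measure of a
  non-measurable set. The rest of the theory shows that neither convention is ever invoked above,
  and that the two operators map into the bounded continuous functions on the trajectory space.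
\<close>

lemma space_borel_measure_of: "space (borel_measure_of X) = topspace X"
  unfolding borel_measure_of_def by (rule space_measure_of) (auto dest: openin_subset)

lemma sets_borel_measure_of: "sets (borel_measure_of X) = sigma_sets (topspace X) {G. openin X G}"
  unfolding borel_measure_of_def by (rule sets_measure_of) (auto dest: openin_subset)

lemma closedin_borel_measure_of:
  assumes "closedin X C" shows "C \<in> sets (borel_measure_of X)"
proof -
  have "topspace X - C \<in> sets (borel_measure_of X)"
    unfolding sets_borel_measure_of using assms by (intro sigma_sets.Basic) (auto simp: closedin_def)
  then have "space (borel_measure_of X) - (topspace X - C) \<in> sets (borel_measure_of X)"
    by (rule sets.compl_sets)
  moreover have "space (borel_measure_of X) - (topspace X - C) = C"
    using closedin_subset[OF assms] by (auto simp: space_borel_measure_of)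
  ultimately show ?thesis by simp
qed

lemma continuous_map_borel_measurable:
  assumes "continuous_map X euclideanreal g"
  shows "g \<in> borel_measurable (borel_measure_of X)"
proof (rule borel_measurableI)
  fix S :: "real set" assume "open S"
  then have "openin X {x \<in> topspace X. g x \<in> S}"
    using assms by (simp add: continuous_map)
  then have "{x \<in> topspace X. g x \<in> S} \<in> sets (borel_measure_of X)"
    unfolding sets_borel_measure_of by (intro sigma_sets.Basic) auto
  moreover have "g -` S \<inter> space (borel_measure_of X) = {x \<in> topspace X. g x \<in> S}"
    by (auto simp: space_borel_measure_of)
  ultimately show "g -` S \<inter> space (borel_measure_of X) \<in> sets (borel_measure_of X)" by simp
qed

lemma integrable_Cb:
  assumes "\<mu> \<in> borel_probs X" and "g \<in> Cb X"
  shows "integrable \<mu> g"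
proof -
  interpret prob_space \<mu> using assms(1) by (simp add: borel_probs_def)
  have s: "sets \<mu> = sets (borel_measure_of X)" using assms(1) by (simp add: borel_probs_def)
  have sp: "space \<mu> = topspace X"
    using sets_eq_imp_space_eq[OF s] by (simp add: space_borel_measure_of)
  have "g \<in> borel_measurable \<mu>"
    using continuous_map_borel_measurable assms(2) measurable_cong_sets[OF s refl]
    by (auto simp: Cb_def)
  moreover obtain B where "\<forall>x\<in>topspace X. norm (g x) \<le> B"
    using assms(2) by (auto simp: Cb_def bounded_iff)
  then have "AE x in \<mu>. norm (g x) \<le> B" using sp by (intro AE_I2) auto
  ultimately show ?thesis by (rule integrable_const_bound[rotated])
qed

lemma continuous_map_coord_X:
  assumes "t \<le> T" shows "continuous_map (traj_space T X U Y) X (coord_X t)"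
proof -
  have "continuous_map (traj_space T X U Y) X ((\<lambda>a. a t) \<circ> fst)"
    unfolding traj_space_def using assms
    by (intro continuous_map_compose[OF continuous_map_fst] continuous_map_product_projection) auto
  then show ?thesis by (simp add: coord_X_def[abs_def] o_def)
qed

lemma continuous_map_coord_U:
  assumes "t < T" shows "continuous_map (traj_space T X U Y) U (coord_U t)"
proof -
  have "continuous_map (traj_space T X U Y) U ((\<lambda>a. a t) \<circ> (fst \<circ> snd))"
    unfolding traj_space_def using assms
    by (intro continuous_map_compose[OF continuous_map_compose[OF continuous_map_snd continuous_map_fst]]
          continuous_map_product_projection) auto
  then show ?thesis by (simp add: coord_U_def[abs_def] o_def)
qed

lemma continuous_map_coord_Y:
  assumes "t < T" shows "continuous_map (traj_space T X U Y) Y (coord_Y t)"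
proof -
  have "continuous_map (traj_space T X U Y) Y ((\<lambda>a. a t) \<circ> (snd \<circ> snd))"
    unfolding traj_space_def using assms
    by (intro continuous_map_compose[OF continuous_map_compose[OF continuous_map_snd continuous_map_snd]]
          continuous_map_product_projection) auto
  then show ?thesis by (simp add: coord_Y_def[abs_def] o_def)
qed

lemma continuous_map_coord_XU:
  assumes "continuous_map (prod_topology X U) Z g" and "t < T"
  shows "continuous_map (traj_space T X U Y) Z (\<lambda>\<omega>. g (coord_X t \<omega>, coord_U t \<omega>))"
proof -
  have "continuous_map (traj_space T X U Y) (prod_topology X U) (\<lambda>\<omega>. (coord_X t \<omega>, coord_U t \<omega>))"
    using assms(2) by (intro continuous_map_pairedI continuous_map_coord_X continuous_map_coord_U) auto
  from continuous_map_compose[OF this assms(1)] show ?thesis by (simp add: o_def)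
qed

lemma Cb_compose:
  assumes "\<phi> \<in> Cb Z" and "continuous_map W Z g"
  shows "(\<lambda>w. \<phi> (g w)) \<in> Cb W"
proof -
  have "continuous_map W euclideanreal (\<lambda>w. \<phi> (g w))"
    using continuous_map_compose[OF assms(2)] assms(1) by (force simp: Cb_def o_def)
  moreover have "(\<lambda>w. \<phi> (g w)) ` topspace W \<subseteq> \<phi> ` topspace Z"
    using continuous_map_image_subset_topspace[OF assms(2)] by auto
  ultimately show ?thesis using assms(1) by (auto simp: Cb_def intro: bounded_subset)
qed

lemma Cb_diff:
  assumes "\<phi> \<in> Cb W" and "\<psi> \<in> Cb W"
  shows "(\<lambda>w. \<phi> w - \<psi> w) \<in> Cb W"
  using assms by (auto simp: Cb_def intro: continuous_map_diff bounded_minus_comp)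

lemma L_op_Cb:
  fixes Y :: "'y topology" and \<phi> :: "'x \<Rightarrow> real" and f :: "'x \<times> 'u \<Rightarrow> 'x"
  assumes "continuous_map (prod_topology X U) X f" and "t < T" and "\<phi> \<in> Cb X"
  shows "L_op f t \<phi> \<in> Cb (traj_space T X U Y)"
  unfolding L_op_def[abs_def] using assms
  by (intro Cb_diff Cb_compose[OF assms(3)] continuous_map_coord_X continuous_map_coord_XU) auto

lemma H_op_Cb:
  fixes Y :: "'y topology" and h :: "'x \<times> 'u \<Rightarrow> 'y"
  assumes "continuous_map (prod_topology X U) Y h" and "t < T" and "\<psi> \<in> Cb Y"
  shows "H_op h t \<psi> \<in> Cb (traj_space T X U Y)"
  unfolding H_op_def[abs_def] using assms
  by (intro Cb_diff Cb_compose[OF assms(3)] continuous_map_coord_Y continuous_map_coord_XU) auto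

lemma metric_square_Cb:
  assumes d: "compatible_bounded_metric Z d"
    and g: "continuous_map W Z g" and k: "continuous_map W Z k"
  shows "(\<lambda>w. (d (g w) (k w))\<^sup>2) \<in> Cb W"
proof -
  interpret Metric_space "topspace Z" d using d by (simp add: compatible_bounded_metric_def)
  have Z: "mtopology = Z" and b: "mbounded (topspace Z)"
    using d by (auto simp: compatible_bounded_metric_def)
  have c: "continuous_map W euclideanreal (\<lambda>w. d (g w) (k w))"
    using continuous_map_mdist[of W "metric (topspace Z, d)" g k] g k
    by (simp add: mtopology_of_def Z)
  obtain B where B: "\<forall>x\<in>topspace Z. \<forall>y\<in>topspace Z. d x y \<le> B"
    using b by (auto simp: mbounded_alt)
  have "\<bar>(d (g w) (k w))\<^sup>2\<bar> \<le> B\<^sup>2" if "w \<in> topspace W" for w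
  proof -
    have "g w \<in> topspace Z" "k w \<in> topspace Z"
      using that continuous_map_image_subset_topspace[OF g] continuous_map_image_subset_topspace[OF k]
      by blast+
    then have "d (g w) (k w) \<le> B" using B by blast
    then show ?thesis by (auto intro!: power_mono)
  qed
  then have "bounded ((\<lambda>w. (d (g w) (k w))\<^sup>2) ` topspace W)"
    unfolding bounded_iff by (intro exI[of _ "B\<^sup>2"]) auto
  then show ?thesis using c by (auto simp: Cb_def intro: continuous_map_real_pow)
qed

lemma metric_residual_Cb:
  fixes f :: "'x \<times> 'u \<Rightarrow> 'x" and h :: "'x \<times> 'u \<Rightarrow> 'y"
  assumes "continuous_map (prod_topology X U) X f" and "continuous_map (prod_topology X U) Y h"
    and "compatible_bounded_metric X dX" and "compatible_bounded_metric Y dY" and "t < T"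
  shows "metric_residual f h dX dY t \<in> Cb (traj_space T X U Y)"
proof -
  have 1: "(\<lambda>\<omega>. (dX (coord_X (Suc t) \<omega>) (f (coord_X t \<omega>, coord_U t \<omega>)))\<^sup>2) \<in> Cb (traj_space T X U Y)"
    using assms by (intro metric_square_Cb[OF assms(3)] continuous_map_coord_X continuous_map_coord_XU) auto
  have 2: "(\<lambda>\<omega>. (dY (coord_Y t \<omega>) (h (coord_X t \<omega>, coord_U t \<omega>)))\<^sup>2) \<in> Cb (traj_space T X U Y)"
    using assms by (intro metric_square_Cb[OF assms(4)] continuous_map_coord_Y continuous_map_coord_XU) auto
  show ?thesis using 1 2
    by (auto simp: metric_residual_def[abs_def] Cb_def intro: continuous_map_add bounded_plus_comp)
qed

lemma closedin_admissible_paths: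
  fixes f :: "'x \<times> 'u \<Rightarrow> 'x" and h :: "'x \<times> 'u \<Rightarrow> 'y"
  assumes "polish_topology X" and "polish_topology Y"
    and f: "continuous_map (prod_topology X U) X f" and h: "continuous_map (prod_topology X U) Y h"
  shows "closedin (traj_space T X U Y) (admissible_paths T X U Y f h)"
proof -
  let ?W = "traj_space T X U Y"
  let ?A = "\<lambda>t. {\<omega> \<in> topspace ?W. coord_X (Suc t) \<omega> = f (coord_X t \<omega>, coord_U t \<omega>)}"
  let ?B = "\<lambda>t. {\<omega> \<in> topspace ?W. coord_Y t \<omega> = h (coord_X t \<omega>, coord_U t \<omega>)}"
  have HX: "Hausdorff_space X" and HY: "Hausdorff_space Y"
    using assms(1,2) by (auto simp: polish_topology_def
        intro: metrizable_imp_Hausdorff_space completely_metrizable_imp_metrizable_space)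
  have A: "closedin ?W (?A t)" if "t < T" for t
    using that by (intro closedin_continuous_maps_eq[OF HX] continuous_map_coord_X continuous_map_coord_XU f) auto
  have B: "closedin ?W (?B t)" if "t < T" for t
    using that by (intro closedin_continuous_maps_eq[OF HY] continuous_map_coord_Y continuous_map_coord_XU h) auto
  have "admissible_paths T X U Y f h = topspace ?W \<inter> \<Inter>((\<lambda>t. ?A t \<inter> ?B t) ` {..<T})"
    by (auto simp: admissible_paths_def)
  moreover have "closedin ?W (topspace ?W \<inter> \<Inter>((\<lambda>t. ?A t \<inter> ?B t) ` {..<T}))"
  proof (cases "T = 0")
    case False
    then show ?thesis by (intro closedin_Int closedin_topspace closedin_Inter) (auto intro!: A B closedin_Int)
  qed auto
  ultimately show ?thesis by simp
qed

lemma admissible_paths_measurable: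
  assumes "polish_topology X" and "polish_topology Y"
    and "continuous_map (prod_topology X U) X f" and "continuous_map (prod_topology X U) Y h"
    and "\<mu> \<in> borel_probs (traj_space T X U Y)"
  shows "admissible_paths T X U Y f h \<in> sets \<mu>"
  using closedin_borel_measure_of[OF closedin_admissible_paths[OF assms(1-4)]] assms(5)
  by (simp add: borel_probs_def)

end

theory Submission
  imports Defs
begin

text \<open>
  Conditions (i) and (ii) are two spellings of one property: at each time, almost surely the
  dynamics and the output equation hold. For (i), a measurable set has probability one iff almost
  every point lies in it, and a finite conjunction over times holds almost surely iff each conjunct
  does (\<open>behavioral_iff_AE_equations\<close>). For (ii), the residual is a bounded continuous nonnegative
  function, so its integral vanishes iff it vanishes almost surely, and a sum of two squared
  distances is zero exactly when both equations hold (\<open>metric_residual_iff_AE_equations\<close>).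
  The equations make the two terms of each \<open>L_op\<close> and \<open>H_op\<close> cancel almost surely, whence (iii).

  The weak identities say only that \<open>X\<^sub>t\<^sub>+\<^sub>1\<close> has the law of \<open>f (X\<^sub>t, U\<^sub>t)\<close> and \<open>Y\<^sub>t\<close> that of
  \<open>h (X\<^sub>t, U\<^sub>t)\<close>, and two random points with the same law need not coincide. The counterexample uses
  the dynamics \<open>f (x, u) = x\<close> over one step: a fair coin decides between the state paths \<open>(0, 1)\<close>
  and \<open>(1, 0)\<close>. Both states are then uniform on \<open>{0, 1}\<close>, yet they differ on every path
  (\<open>swap_weak_operator_identities\<close>, \<open>swap_not_behavioral\<close>).
\<close>

lemma space_borel_probs:
  assumes "\<mu> \<in> borel_probs X"
  shows "space \<mu> = topspace X"
  using assms sets_eq_imp_space_eq[of \<mu> "borel_measure_of X"]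
  by (simp add: borel_probs_def space_borel_measure_of)

definition system_equations ::
  "('x \<times> 'u \<Rightarrow> 'x) \<Rightarrow> ('x \<times> 'u \<Rightarrow> 'y) \<Rightarrow> nat \<Rightarrow> ('x, 'u, 'y) traj \<Rightarrow> bool" where
  "system_equations f h t \<omega> \<longleftrightarrow>
     coord_X (Suc t) \<omega> = f (coord_X t \<omega>, coord_U t \<omega>) \<and>
     coord_Y t \<omega> = h (coord_X t \<omega>, coord_U t \<omega>)"

lemma behavioral_iff_AE_equations:
  assumes "polish_topology X" and "polish_topology Y"
    and "continuous_map (prod_topology X U) X f" and "continuous_map (prod_topology X U) Y h"
    and mu: "\<mu> \<in> borel_probs (traj_space T X U Y)"
  shows "\<mu> \<in> behavioral_measures T X U Y f h \<longleftrightarrow> (\<forall>t<T. AE \<omega> in \<mu>. system_equations f h t \<omega>)"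
proof -
  let ?A = "admissible_paths T X U Y f h"
  interpret prob_space \<mu> using mu by (simp add: borel_probs_def)
  have "\<mu> \<in> behavioral_measures T X U Y f h \<longleftrightarrow> prob ?A = 1"
    using mu by (simp add: behavioral_measures_def emeasure_eq_measure)
  also have "\<dots> \<longleftrightarrow> (AE \<omega> in \<mu>. \<omega> \<in> ?A)"
    using admissible_paths_measurable[OF assms] by (simp add: AE_in_set_eq_1)
  also have "\<dots> \<longleftrightarrow> (AE \<omega> in \<mu>. \<forall>t\<in>{..<T}. system_equations f h t \<omega>)"
    by (rule AE_cong)
      (auto simp: admissible_paths_def system_equations_def space_borel_probs[OF mu])
  also have "\<dots> \<longleftrightarrow> (\<forall>t<T. AE \<omega> in \<mu>. system_equations f h t \<omega>)"
    by (subst AE_ball_countable) auto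
  finally show ?thesis .
qed

text \<open>
  A metric separates points of its carrier only, so the four states and outputs that are compared
  have to be located in the carriers first; this is where \<open>\<omega>\<close> must be a genuine trajectory.
\<close>

lemma metric_residual_eq_0_iff:
  fixes f :: "'x \<times> 'u \<Rightarrow> 'x" and h :: "'x \<times> 'u \<Rightarrow> 'y"
  assumes f: "continuous_map (prod_topology X U) X f" and h: "continuous_map (prod_topology X U) Y h"
    and dX: "compatible_bounded_metric X dX" and dY: "compatible_bounded_metric Y dY"
    and "t < T" and \<omega>: "\<omega> \<in> topspace (traj_space T X U Y)"
  shows "metric_residual f h dX dY t \<omega> = 0 \<longleftrightarrow> system_equations f h t \<omega>"
proof -
  interpret DX: Metric_space "topspace X" dX using dX by (simp add: compatible_bounded_metric_def)
  interpret DY: Metric_space "topspace Y" dY using dY by (simp add: compatible_bounded_metric_def)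
  have in_topspace: "g \<omega> \<in> topspace Z" if "continuous_map (traj_space T X U Y) Z g" for Z g
    using continuous_map_image_subset_topspace[OF that] \<omega> by auto
  have "coord_X (Suc t) \<omega> \<in> topspace X" "f (coord_X t \<omega>, coord_U t \<omega>) \<in> topspace X"
    using assms by (auto intro!: in_topspace[OF continuous_map_coord_X]
        in_topspace[OF continuous_map_coord_XU])
  moreover have "coord_Y t \<omega> \<in> topspace Y" "h (coord_X t \<omega>, coord_U t \<omega>) \<in> topspace Y"
    using assms by (auto intro!: in_topspace[OF continuous_map_coord_Y]
        in_topspace[OF continuous_map_coord_XU])
  ultimately show ?thesis
    by (simp add: metric_residual_def system_equations_def sum_power2_eq_zero_iff)
qed

lemma metric_residual_iff_AE_equations:
  fixes f :: "'x \<times> 'u \<Rightarrow> 'x" and h :: "'x \<times> 'u \<Rightarrow> 'y"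
  assumes f: "continuous_map (prod_topology X U) X f" and h: "continuous_map (prod_topology X U) Y h"
    and dX: "compatible_bounded_metric X dX" and dY: "compatible_bounded_metric Y dY"
    and mu: "\<mu> \<in> borel_probs (traj_space T X U Y)"
  shows "metric_residual_condition T f h dX dY \<mu>
           \<longleftrightarrow> (\<forall>t<T. AE \<omega> in \<mu>. system_equations f h t \<omega>)"
proof -
  have "(\<integral>\<omega>. metric_residual f h dX dY t \<omega> \<partial>\<mu>) = 0 \<longleftrightarrow> (AE \<omega> in \<mu>. system_equations f h t \<omega>)"
    if t: "t < T" for t
  proof -
    have "(\<integral>\<omega>. metric_residual f h dX dY t \<omega> \<partial>\<mu>) = 0
            \<longleftrightarrow> (AE \<omega> in \<mu>. metric_residual f h dX dY t \<omega> = 0)"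
      by (rule integral_nonneg_eq_0_iff_AE[OF
            integrable_Cb[OF mu metric_residual_Cb[OF f h dX dY t]]])
        (simp add: metric_residual_def)
    also have "\<dots> \<longleftrightarrow> (AE \<omega> in \<mu>. system_equations f h t \<omega>)"
      by (rule AE_cong) (simp add: metric_residual_eq_0_iff[OF f h dX dY t] space_borel_probs[OF mu])
    finally show ?thesis .
  qed
  then show ?thesis by (simp add: metric_residual_condition_def)
qed

lemma AE_equations_imp_weak_operator_identities:
  assumes "\<forall>t<T. AE \<omega> in \<mu>. system_equations f h t \<omega>"
  shows "weak_operator_identities T X Y f h \<mu>"
  unfolding weak_operator_identities_def
proof (intro allI impI ballI conjI)
  fix t \<phi> \<psi> assume "t < T"
  then have eqs: "AE \<omega> in \<mu>. system_equations f h t \<omega>" using assms by blast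
  show "(\<integral>\<omega>. L_op f t \<phi> \<omega> \<partial>\<mu>) = 0"
    by (rule integral_eq_zero_AE, use eqs in eventually_elim)
      (simp add: L_op_def system_equations_def)
  show "(\<integral>\<omega>. H_op h t \<psi> \<omega> \<partial>\<mu>) = 0"
    by (rule integral_eq_zero_AE, use eqs in eventually_elim)
      (simp add: H_op_def system_equations_def)
qed

lemma polish_topology_euclidean:
  "polish_topology (euclidean :: 'a::{complete_space, second_countable_topology} topology)"
proof -
  obtain D :: "'a set" where "countable D" and "\<And>S. open S \<Longrightarrow> S \<noteq> {} \<Longrightarrow> \<exists>d\<in>D. d \<in> S"
    using countable_dense_exists by blast
  then have "separable_space (euclidean :: 'a topology)"
    unfolding separable_space_def dense_intersects_open by (intro exI[of _ D]) auto
  then show ?thesis by (simp add: polish_topology_def completely_metrizable_space_euclidean)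
qed

text \<open>
  The coin \<open>b\<close> is the initial state, and the next state is its negation; inputs and outputs are zero.
  Restriction to the index sets is needed for the path to be a point of the product spaces.
\<close>

definition swap_path :: "bool \<Rightarrow> (real, real, real) traj" where
  "swap_path b =
     (\<lambda>t\<in>{0..1}. of_bool (b = (t = 0)), \<lambda>t\<in>{0..<1}. 0, \<lambda>t\<in>{0..<1}. 0)"

abbreviation swap_space :: "(real, real, real) traj topology" where
  "swap_space \<equiv> traj_space 1 euclideanreal euclideanreal euclideanreal"

definition swap_measure :: "(real, real, real) traj measure" where
  "swap_measure = distr (measure_pmf (pmf_of_set UNIV)) (borel_measure_of swap_space) swap_path"

lemma coord_swap_path:
  "coord_X 0 (swap_path b) = of_bool b" "coord_X 1 (swap_path b) = of_bool (\<not> b)"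
  "coord_Y 0 (swap_path b) = 0"
  by (auto simp: swap_path_def coord_X_def coord_Y_def)

lemma measurable_swap_path:
  "swap_path \<in> measurable (measure_pmf p) (borel_measure_of swap_space)"
  by (simp add: space_borel_measure_of traj_space_def swap_path_def)

lemma swap_measure_borel_probs: "swap_measure \<in> borel_probs swap_space"
  unfolding borel_probs_def swap_measure_def
  by (intro CollectI conjI measure_pmf.prob_space_distr measurable_swap_path sets_distr)

lemma integral_swap_measure:
  assumes "g \<in> Cb swap_space"
  shows "(\<integral>\<omega>. g \<omega> \<partial>swap_measure) = (g (swap_path False) + g (swap_path True)) / 2"
proof -
  have "g \<in> borel_measurable (borel_measure_of swap_space)"
    using assms by (auto simp: Cb_def intro: continuous_map_borel_measurable)
  then have "(\<integral>\<omega>. g \<omega> \<partial>swap_measure) = measure_pmf.expectation (pmf_of_set UNIV) (\<lambda>b. g (swap_path b))"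
    unfolding swap_measure_def by (rule integral_distr[OF measurable_swap_path])
  also have "\<dots> = (g (swap_path False) + g (swap_path True)) / 2"
    by (simp add: integral_pmf_of_set UNIV_bool)
  finally show ?thesis .
qed

text \<open>
  Exchanging the two coin values exchanges the two states, so the contributions
  \<open>\<phi> 1 - \<phi> 0\<close> and \<open>\<phi> 0 - \<phi> 1\<close> of the two paths cancel. The output equation holds exactly.
\<close>

lemma swap_weak_operator_identities:
  "weak_operator_identities 1 euclideanreal euclideanreal fst (\<lambda>_. 0) swap_measure"
  unfolding weak_operator_identities_def
proof (intro allI impI ballI conjI)
  fix t :: nat and \<phi> \<psi> :: "real \<Rightarrow> real"
  assume t: "t < 1" and \<phi>: "\<phi> \<in> Cb euclideanreal" and \<psi>: "\<psi> \<in> Cb euclideanreal"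
  have "L_op fst t \<phi> \<in> Cb swap_space"
    by (rule L_op_Cb[OF continuous_map_fst t \<phi>])
  then show "(\<integral>\<omega>. L_op fst t \<phi> \<omega> \<partial>swap_measure) = 0"
    using t by (subst integral_swap_measure) (simp_all add: L_op_def coord_swap_path[unfolded One_nat_def])
  have "H_op (\<lambda>_. 0) t \<psi> \<in> Cb swap_space"
    by (rule H_op_Cb[OF _ t \<psi>]) simp
  then show "(\<integral>\<omega>. H_op (\<lambda>_. 0) t \<psi> \<omega> \<partial>swap_measure) = 0"
    using t by (subst integral_swap_measure) (simp_all add: H_op_def coord_swap_path)
qed

lemma swap_not_behavioral:
  "swap_measure \<notin> behavioral_measures 1 euclideanreal euclideanreal euclideanreal fst (\<lambda>_. 0)"
proof -
  let ?A = "admissible_paths 1 euclideanreal euclideanreal euclideanreal fst (\<lambda>_. 0)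
              :: (real, real, real) traj set"
  have "?A \<in> sets swap_measure"
    by (rule admissible_paths_measurable[OF polish_topology_euclidean polish_topology_euclidean
          continuous_map_fst _ swap_measure_borel_probs]) simp
  then have "emeasure swap_measure ?A = emeasure (measure_pmf (pmf_of_set UNIV)) (swap_path -` ?A)"
    unfolding swap_measure_def by (subst emeasure_distr[OF measurable_swap_path]) auto
  also have "swap_path -` ?A = {}"
    using coord_swap_path by (auto simp: admissible_paths_def)
  finally show ?thesis by (simp add: behavioral_measures_def)
qed

theorem proposition2p4:
  shows
    "(\<forall>(T::nat) (X::'x topology) (U::'u topology) (Y::'y topology)
        (f::'x \<times> 'u \<Rightarrow> 'x) (h::'x \<times> 'u \<Rightarrow> 'y)
        (dX::'x \<Rightarrow> 'x \<Rightarrow> real) (dY::'y \<Rightarrow> 'y \<Rightarrow> real).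
        polish_topology X \<and> polish_topology U \<and> polish_topology Y \<and>
        continuous_map (prod_topology X U) X f \<and> continuous_map (prod_topology X U) Y h \<and>
        compatible_bounded_metric X dX \<and> compatible_bounded_metric Y dY \<longrightarrow>
        (\<forall>\<mu> \<in> borel_probs (traj_space T X U Y).
           (\<mu> \<in> behavioral_measures T X U Y f h \<longleftrightarrow> metric_residual_condition T f h dX dY \<mu>) \<and>
           (metric_residual_condition T f h dX dY \<mu> \<longrightarrow> weak_operator_identities T X Y f h \<mu>)))
     \<and>
     (\<exists>(T::nat) (X::real topology) (U::real topology) (Y::real topology) f h.
        polish_topology X \<and> polish_topology U \<and> polish_topology Y \<and>
        continuous_map (prod_topology X U) X f \<and> continuous_map (prod_topology X U) Y h \<and>
        (\<exists>\<mu> \<in> borel_probs (traj_space T X U Y).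
           weak_operator_identities T X Y f h \<mu> \<and> \<mu> \<notin> behavioral_measures T X U Y f h))"
proof (intro conjI)
  show "\<exists>(T::nat) (X::real topology) (U::real topology) (Y::real topology) f h.
        polish_topology X \<and> polish_topology U \<and> polish_topology Y \<and>
        continuous_map (prod_topology X U) X f \<and> continuous_map (prod_topology X U) Y h \<and>
        (\<exists>\<mu> \<in> borel_probs (traj_space T X U Y).
           weak_operator_identities T X Y f h \<mu> \<and> \<mu> \<notin> behavioral_measures T X U Y f h)"
    by (intro exI[of _ 1] exI[of _ euclideanreal] exI[of _ fst] exI[of _ "\<lambda>_. 0"] conjI
        bexI[OF _ swap_measure_borel_probs] swap_weak_operator_identities swap_not_behavioral
        polish_topology_euclidean continuous_map_fst) simp
qed (intro allI impI ballI conjI; elim conjE;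
    simp add: behavioral_iff_AE_equations metric_residual_iff_AE_equations
      AE_equations_imp_weak_operator_identities)

end
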